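(* Suppose that the cost distribution is uniform on the interval $[0,1]$. Then the share $\mu(\lambda)$ of rewards received by malicious agents, as a function of $\lambda\in\left[\frac{M}{H+M},1\right]$, is minimized for $\lambda=\frac{M}{H+M}$. Moreover, on the interval $\left[\frac{M}{H+M},1\right]$ the function $\mu(\lambda)$ is either increasing, or first increasing and then decreasing.
   Context: There is a continuum of honest agents of measure $H$ and of malicious agents of measure $M$, with $H>M>0$; $R>0$ is the block reward and $\lambda\in(0,1]$ the share of a pool's reward kept by its owner. Honest agents' costs of running a staking pool have cumulative distribution function $F$; here $F(c)=\min\{c,1\}$ for $c\ge 0$. Malicious agents always run pools; honest agents run a pool or delegate. For $\lambda>\frac{M}{H+M}$, the equilibrium threshold $c^*=c^*(\lambda)>0$ (honest agents with cost below $c^*$ run pools, those above delegate) is the unique positive solution of the indifference condition $$c^*=\frac{\lambda R}{F(c^* )H+M}-\frac{(1-\lambda)R}{(1-F(c^* ))H},$$ where the last fraction is read as $0$ if $\lambda=1$ and, if $\lambda<1$, a solution must satisfy $F(c^* )<1$. For $\lambda=\frac{M}{H+M}$, the only solution is $c^*=0$, and we set $c^*\left(\frac{M}{H+M}\right)=0$. The share of rewards received by malicious agents is $$\mu(\lambda)=\frac{M\lambda}{F(c^*(\lambda))H+M}.$$ *)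

theory Defs
  imports "HOL-Probability.Probability"
begin

text \<open>Costs have distribution function \<open>F\<close>; honest and malicious agents have measures \<open>H\<close> and
  \<open>M\<close>; \<open>R\<close> is the block reward and \<open>l\<close> the pool owner's share. An honest agent of cost \<open>c\<close> is
  indifferent between running a pool and delegating when all honest agents with cost below \<open>c\<close>
  run pools.\<close>

definition indifferent :: "(real \<Rightarrow> real) \<Rightarrow> real \<Rightarrow> real \<Rightarrow> real \<Rightarrow> real \<Rightarrow> real \<Rightarrow> bool" where
  "indifferent F H M R l c \<longleftrightarrow>
     (l < 1 \<longrightarrow> F c < 1) \<and>
     c = l * R / (F c * H + M) - (if l = 1 then 0 else (1 - l) * R / ((1 - F c) * H))"

text \<open>The description is only meaningful where the positive solution exists and is unique; the
  intended range of \<open>l\<close> is \<open>{M / (H + M)..1}\<close>.\<close>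

definition threshold :: "(real \<Rightarrow> real) \<Rightarrow> real \<Rightarrow> real \<Rightarrow> real \<Rightarrow> real \<Rightarrow> real" where
  "threshold F H M R l =
     (if l = M / (H + M) then 0 else (THE c. c > 0 \<and> indifferent F H M R l c))"

definition malicious_share :: "(real \<Rightarrow> real) \<Rightarrow> real \<Rightarrow> real \<Rightarrow> real \<Rightarrow> real \<Rightarrow> real" where
  "malicious_share F H M R l = M * l / (F (threshold F H M R l) * H + M)"

lemma cdf_uniform_unit_interval:
  assumes "0 \<le> c"
  shows "cdf (uniform_measure lborel {0..1::real}) c = min c 1"
proof -
  have "{0..1} \<inter> {..c} = {0..min c 1}"
    by auto
  then show ?thesis
    using assms by (simp add: cdf_def measure_uniform_measure)
qed

end

theory Submission
  imports Defs
begin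

text \<open>Let \<open>x = F c\<^sup>*\<close> be the share of honest agents running pools. Clearing denominators, the
  indifference condition becomes \<open>(H + M) \<lambda> = (x H + M) (1 + x (1 - x) H / R)\<close>, so that
  \<open>\<mu> = M / (H + M) (1 + x (1 - x) H / R)\<close> is a parabola in \<open>x \<in> [0, 1]\<close> with its peak at \<open>1/2\<close>
  and its minimum at \<open>x = 0\<close>. Since the right-hand side of the indifference condition increases
  in \<open>\<lambda>\<close> and decreases in \<open>c\<^sup>*\<close>, the share \<open>x\<close> increases with \<open>\<lambda>\<close>, and \<open>\<mu>\<close> turns around exactly
  where \<open>x\<close> passes \<open>1/2\<close>, if it does so before \<open>\<lambda> = 1\<close>.\<close>

locale uniform_costs =
  fixes H M R :: real and F :: "real \<Rightarrow> real"
  assumes H_pos: "0 < H" and M_pos: "0 < M" and R_pos: "0 < R"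
    and F_eq: "0 \<le> c \<Longrightarrow> F c = min c 1"
begin

abbreviation "lowest \<equiv> M / (H + M)"

text \<open>This is \<lambda> as a function of x. For R < H + M it exceeds 1 just below x = 1, where
  it returns to 1, so it need not be monotone on [0, 1].\<close>

definition share_of :: "real \<Rightarrow> real" where
  "share_of x = (x * H + M) * (1 + x * (1 - x) * H / R) / (H + M)"

definition running :: "real \<Rightarrow> real" where
  "running l = F (threshold F H M R l)"

text \<open>The second fraction may be written without the case distinction, as \<open>(1 - l) * R = 0\<close>
  for \<open>l = 1\<close>.\<close>

lemma indifferent_iff:
  "indifferent F H M R l c \<longleftrightarrow>
     (l < 1 \<longrightarrow> F c < 1) \<and> c = l * R / (F c * H + M) - (1 - l) * R / ((1 - F c) * H)"
  by (auto simp: indifferent_def)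

lemma indifferent_iff_share_of:
  assumes "0 < c" "c < 1"
  shows "indifferent F H M R l c \<longleftrightarrow> l = share_of c"
proof -
  have Fc: "F c = c" using assms F_eq[of c] by simp
  have pos: "0 < c * H + M" "0 < (1 - c) * H" "0 < H + M"
    using assms H_pos M_pos by (auto intro: add_pos_pos)
  have "indifferent F H M R l c \<longleftrightarrow> c = l * R / (c * H + M) - (1 - l) * R / ((1 - c) * H)"
    using assms by (simp add: indifferent_iff Fc)
  also have "\<dots> \<longleftrightarrow> c * (c * H + M) * ((1 - c) * H) = l * R * ((1 - c) * H) - (1 - l) * R * (c * H + M)"
    using pos by (subst diff_frac_eq) (auto simp: eq_divide_eq mult.assoc)
  \<comment> \<open>The coefficients of l add up because (1 - c) H + (c H + M) = H + M.\<close>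
  also have "\<dots> \<longleftrightarrow> l * ((H + M) * R) = (c * H + M) * (R + c * (1 - c) * H)"
    by (auto simp: algebra_simps)
  also have "\<dots> \<longleftrightarrow> l = (c * H + M) * (R + c * (1 - c) * H) / ((H + M) * R)"
    using pos R_pos by (simp add: eq_divide_eq)
  also have "(c * H + M) * (R + c * (1 - c) * H) / ((H + M) * R) = share_of c"
    using pos R_pos by (simp add: share_of_def field_simps)
  finally show ?thesis .
qed

text \<open>Here \<open>F c = 1\<close>, which excludes l < 1, and the delegation term of
  \<open>indifferent_iff\<close> is a division by zero, hence 0.\<close>

lemma indifferent_one_iff:
  assumes "1 \<le> c"
  shows "indifferent F H M R l c \<longleftrightarrow> 1 \<le> l \<and> c = l * R / (H + M)"
  using assms F_eq[of c] by (auto simp: indifferent_iff min_def)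

text \<open>The argument is \<open>F c\<close> rather than c because a threshold may be 1 or more;
  then l = 1, which is \<open>share_of 1\<close>.\<close>

lemma indifferent_imp_share_of:
  assumes "0 < c" "indifferent F H M R l c" "l \<le> 1"
  shows "l = share_of (F c)"
proof (cases "c < 1")
  case True
  then show ?thesis using assms F_eq[of c] indifferent_iff_share_of by simp
next
  case False
  then show ?thesis
    using assms F_eq[of c] indifferent_one_iff[of c l] H_pos M_pos by (simp add: share_of_def)
qed

section \<open>Monotonicity, existence and uniqueness of the threshold\<close>

text \<open>If c exceeded c', passing from (l, c) to (l', c') could not lower the right-hand side, a
  contradiction. The fractions are compared directly, as \<open>share_of\<close> need not be
  monotone. Uniqueness is the case l = l'.\<close>

lemma indifferent_mono:
  assumes l: "0 \<le> l" "l \<le> l'" "l' \<le> 1"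
    and c: "0 < c" "indifferent F H M R l c" and c': "0 < c'" "indifferent F H M R l' c'"
  shows "c \<le> c'"
proof (rule ccontr)
  assume "\<not> c \<le> c'"
  then have "F c' \<le> F c" "0 < F c'" "F c \<le> 1"
    using c c' F_eq[of c] F_eq[of c'] by auto
  have "l * R / (F c * H + M) \<le> l' * R / (F c' * H + M)"
    using l R_pos H_pos M_pos \<open>F c' \<le> F c\<close> \<open>0 < F c'\<close>
    by (intro frac_le) (auto intro: add_nonneg_pos)
  moreover have "(1 - l') * R / ((1 - F c') * H) \<le> (1 - l) * R / ((1 - F c) * H)"
  \<comment> \<open>For l = 1 also l' = 1 and both numerators vanish; for l < 1 the condition itself
    provides \<open>F c < 1\<close>, so the denominators are positive.\<close>
  proof (cases "l = 1")
    case True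
    then show ?thesis using l by simp
  next
    case False
    then have "F c < 1" using c l by (simp add: indifferent_iff)
    then show ?thesis
      using l R_pos H_pos \<open>F c' \<le> F c\<close> by (intro frac_le) auto
  qed
  ultimately have "c \<le> c'"
    using c c' unfolding indifferent_iff by linarith
  then show False using \<open>\<not> c \<le> c'\<close> by simp
qed

lemma indifferent_exists:
  assumes "lowest < l" "l \<le> 1"
  shows "\<exists>c>0. indifferent F H M R l c"
proof (cases "l = 1")
  case True
  show ?thesis
  \<comment> \<open>For l = 1 the condition reads c (F c H + M) = R, with a solution below 1 exactly
    if R < H + M. Solving \<open>share_of c = 1\<close> instead might only return c = 1.\<close>
  proof (cases "R < H + M")
    case R: True
    have "\<exists>c\<ge>0. c \<le> 1 \<and> c * (c * H + M) = R"
      using R R_pos by (intro IVT) auto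
    then obtain c where c: "0 \<le> c" "c \<le> 1" "c * (c * H + M) = R" by auto
    then have "0 < c" "c < 1" using R R_pos by (auto simp: less_le)
    moreover have "c = R / (c * H + M)"
      using c H_pos M_pos R_pos by (auto simp: eq_divide_eq)
    ultimately have "indifferent F H M R l c"
      using True F_eq[of c] by (simp add: indifferent_iff)
    then show ?thesis using \<open>0 < c\<close> by blast
  next
    case False
    then have "1 \<le> R / (H + M)" using H_pos M_pos by simp
    then show ?thesis
      using True indifferent_one_iff[of "R / (H + M)" l] by (intro exI[of _ "R / (H + M)"]) auto
  qed
next
  case False
  \<comment> \<open>The end values are \<open>lowest\<close> and 1, so an intermediate value l < 1
    is attained strictly inside (0, 1).\<close>
  have "share_of 0 < l" "l < share_of 1"
    using assms False H_pos M_pos by (auto simp: share_of_def)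
  moreover have "\<exists>c\<ge>0. c \<le> 1 \<and> share_of c = l"
    using calculation H_pos M_pos R_pos by (intro IVT) (auto simp: share_of_def)
  then obtain c where c: "0 \<le> c" "c \<le> 1" "share_of c = l" by auto
  ultimately have "0 < c" "c < 1" by (auto simp: less_le)
  then show ?thesis using c indifferent_iff_share_of[of c l] by auto
qed

lemma threshold_unique:
  assumes "lowest < l" "l \<le> 1" "0 < c" "indifferent F H M R l c"
  shows "threshold F H M R l = c"
proof -
  have "0 < lowest" using H_pos M_pos by simp
  then have "0 \<le> l" using assms by linarith
  then have "(THE c. 0 < c \<and> indifferent F H M R l c) = c"
    using assms indifferent_mono[of l l] by (intro the_equality) (auto intro: antisym)
  then show ?thesis using assms by (simp add: threshold_def)
qed

lemma threshold_indifferent: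
  assumes "lowest < l" "l \<le> 1"
  shows "0 < threshold F H M R l" "indifferent F H M R l (threshold F H M R l)"
  using indifferent_exists[OF assms] threshold_unique[OF assms] by auto

section \<open>The share of honest agents running pools\<close>

lemma running_lowest: "running lowest = 0"
  using F_eq[of 0] by (simp add: running_def threshold_def)

lemma running_bounds:
  assumes "l \<in> {lowest..1}"
  shows "0 \<le> running l" "running l \<le> 1"
  using assms running_lowest threshold_indifferent(1)[of l] F_eq[of "threshold F H M R l"]
  by (cases "l = lowest"; simp add: running_def)+

lemma share_of_running:
  assumes "l \<in> {lowest..1}"
  shows "share_of (running l) = l"
proof (cases "l = lowest")
  case True
  then show ?thesis by (simp add: running_lowest share_of_def)
next
  case False
  then show ?thesis
    using assms threshold_indifferent[of l]
      indifferent_imp_share_of[of "threshold F H M R l" l]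
    by (simp add: running_def)
qed

text \<open>Monotone thresholds give only the weak inequality, as F is flat beyond 1. It is strict
  because \<open>share_of\<close> recovers l from \<open>running l\<close>.\<close>

lemma running_less:
  assumes "l \<in> {lowest..1}" "l' \<in> {lowest..1}" "l < l'"
  shows "running l < running l'"
proof -
  have "0 < lowest" using H_pos M_pos by simp
  have "running l \<le> running l'"
  proof (cases "l = lowest")
    case True
    then show ?thesis using assms running_bounds[of l'] running_lowest by simp
  next
    case False
    then have "0 < threshold F H M R l" "threshold F H M R l \<le> threshold F H M R l'"
      using assms threshold_indifferent[of l] threshold_indifferent[of l'] \<open>0 < lowest\<close>
        indifferent_mono[of l l' "threshold F H M R l" "threshold F H M R l'"]
      by auto
    then show ?thesis
      using F_eq[of "threshold F H M R l"] F_eq[of "threshold F H M R l'"]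
      by (simp add: running_def min_def)
  qed
  moreover have "running l \<noteq> running l'"
    using assms share_of_running[of l] share_of_running[of l'] by auto
  ultimately show ?thesis by simp
qed

section \<open>The malicious share as a parabola\<close>

text \<open>Writing l as \<open>share_of (running l)\<close> cancels the denominator x H +
  M.\<close>

lemma malicious_share_eq:
  assumes "l \<in> {lowest..1}"
  shows "malicious_share F H M R l = M / (H + M) * (1 + running l * (1 - running l) * H / R)"
proof -
  have "0 < running l * H + M"
    using running_bounds[OF assms] H_pos M_pos by (simp add: add_nonneg_pos)
  moreover have "malicious_share F H M R l = M * share_of (running l) / (running l * H + M)"
    using share_of_running[OF assms] by (simp add: malicious_share_def running_def)
  ultimately show ?thesis by (simp add: share_of_def)
qed

text \<open>The difference x' (1 - x') - x (1 - x) factors, so for x < x' only the comparison of x +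
  x' with 1 matters.\<close>

lemma malicious_share_less_iff:
  assumes "l \<in> {lowest..1}" "l' \<in> {lowest..1}"
  shows "malicious_share F H M R l < malicious_share F H M R l' \<longleftrightarrow>
    0 < (running l' - running l) * (1 - running l - running l')"
proof -
  have "malicious_share F H M R l < malicious_share F H M R l' \<longleftrightarrow>
      running l * (1 - running l) < running l' * (1 - running l')"
    using assms H_pos M_pos R_pos
    by (simp add: malicious_share_eq mult_less_cancel_left_pos divide_less_cancel
        mult_less_cancel_right del: times_divide_eq_left)
  also have "\<dots> \<longleftrightarrow> 0 < (running l' - running l) * (1 - running l - running l')"
    by (simp add: algebra_simps)
  finally show ?thesis .
qed

lemma malicious_share_lowest_le:
  assumes "l \<in> {lowest..1}"
  shows "malicious_share F H M R lowest \<le> malicious_share F H M R l"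
proof -
  have "lowest \<in> {lowest..1}" using H_pos M_pos by simp
  moreover have "0 \<le> running l * (1 - running l)"
    using running_bounds[OF assms] by simp
  ultimately show ?thesis
    using assms malicious_share_less_iff[of l lowest] running_lowest
    by (force simp: not_less[symmetric] mult_less_0_iff zero_less_mult_iff)
qed

lemma strict_mono_on_malicious_share:
  assumes "a \<in> {lowest..1}" "running a \<le> 1 / 2"
  shows "strict_mono_on {lowest..a} (malicious_share F H M R)"
proof (rule strict_mono_onI)
  fix l l' assume l: "l \<in> {lowest..a}" "l' \<in> {lowest..a}" "l < l'"
  have "running l < running l'" using l assms running_less by auto
  moreover have "running l' \<le> running a"
    using l assms running_less[of l' a] by (cases "l' = a") auto
  ultimately show "malicious_share F H M R l < malicious_share F H M R l'"
    using l assms by (subst malicious_share_less_iff) auto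
qed

lemma strict_antimono_on_malicious_share:
  assumes "a \<in> {lowest..1}" "1 / 2 \<le> running a"
  shows "strict_antimono_on {a..1} (malicious_share F H M R)"
proof (rule monotone_onI)
  fix l l' assume l: "l \<in> {a..1}" "l' \<in> {a..1}" "l < l'"
  have "running l < running l'" using l assms running_less by auto
  moreover have "running a \<le> running l"
    using l assms running_less[of a l] by (cases "l = a") auto
  ultimately show "malicious_share F H M R l > malicious_share F H M R l'"
    using l assms by (subst malicious_share_less_iff) (auto intro: mult_neg_neg)
qed

text \<open>No continuity of \<open>running\<close> is used: the turning point is explicitly
  \<open>share_of (1 / 2)\<close>, once this is known to lie strictly between \<open>lowest\<close>
  and 1.\<close>

lemma running_half:
  assumes "1 / 2 < running 1"
  obtains l where "l \<in> {lowest<..<1}" "running l = 1 / 2"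
proof
  define c where "c = threshold F H M R 1"
  have "0 < c" "c = R / (F c * H + M)"
    using threshold_indifferent[of 1] H_pos M_pos by (auto simp: c_def indifferent_iff)
  moreover have "1 / 2 < F c" using assms by (simp add: running_def c_def)
  moreover have "F c \<le> c" using \<open>0 < c\<close> F_eq[of c] by simp
  moreover have "0 < F c * H + M"
    using \<open>1 / 2 < F c\<close> H_pos M_pos by (simp add: add_pos_pos)
  ultimately have "R = c * (F c * H + M)" "1 / 2 < c"
    by (auto simp: eq_divide_eq)
  moreover have "1 / 2 * (1 / 2 * H + M) < c * (F c * H + M)"
    using \<open>1 / 2 < c\<close> \<open>1 / 2 < F c\<close> H_pos M_pos by (intro mult_strict_mono) auto
  \<comment> \<open>At \<lambda> = 1 both c and \<open>F c\<close> exceed 1/2, so R > (H + 2 M) / 4.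
    Multiplied by 4 H, this is \<open>share_of (1 / 2) < 1\<close> with denominators
    cleared.\<close>
  ultimately have "H * (H + 2 * M) < H * (4 * R)" using H_pos by simp
  then have "(1 / 2 * H + M) * (1 + 1 / 2 * (1 - 1 / 2) * H / R) < H + M"
    using R_pos by (simp add: field_simps)
  then have less: "share_of (1 / 2) < 1"
    using H_pos M_pos by (simp add: share_of_def)
  have "M * 1 < (1 / 2 * H + M) * (1 + 1 / 2 * (1 - 1 / 2) * H / R)"
    using H_pos M_pos R_pos by (intro mult_strict_mono) auto
  then have greater: "lowest < share_of (1 / 2)"
    using H_pos M_pos unfolding share_of_def by (intro divide_strict_right_mono) auto
  show "share_of (1 / 2) \<in> {lowest<..<1}" using less greater by simp
  have "threshold F H M R (share_of (1 / 2)) = 1 / 2"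
    using less greater indifferent_iff_share_of[of "1 / 2"] by (intro threshold_unique) auto
  then show "running (share_of (1 / 2)) = 1 / 2"
    by (simp only: running_def F_eq)
qed

end

theorem proposition2:
  fixes H M R :: real and F \<mu> :: "real \<Rightarrow> real"
  assumes "0 < M" and "M < H" and "0 < R"
    and F: "F = cdf (uniform_measure lborel {0..1})"
    and \<mu>: "\<mu> = malicious_share F H M R"
  shows "(\<forall>l \<in> {M / (H + M)..1}. \<mu> (M / (H + M)) \<le> \<mu> l) \<and>
    (strict_mono_on {M / (H + M)..1} \<mu> \<or>
     (\<exists>l\<^sub>1 \<in> {M / (H + M)<..<1}.
        strict_mono_on {M / (H + M)..l\<^sub>1} \<mu> \<and> strict_antimono_on {l\<^sub>1..1} \<mu>))"
proof -
  interpret uniform_costs H M R F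
    using assms by unfold_locales (auto simp: cdf_uniform_unit_interval)
  have one: "1 \<in> {M / (H + M)..1}" using assms by simp
  show ?thesis
  proof (intro conjI ballI)
    fix l assume "l \<in> {M / (H + M)..1}"
    then show "\<mu> (M / (H + M)) \<le> \<mu> l" unfolding \<mu> by (rule malicious_share_lowest_le)
  next
    show "strict_mono_on {M / (H + M)..1} \<mu> \<or>
      (\<exists>l\<^sub>1 \<in> {M / (H + M)<..<1}.
        strict_mono_on {M / (H + M)..l\<^sub>1} \<mu> \<and> strict_antimono_on {l\<^sub>1..1} \<mu>)"
    proof (cases "running 1 \<le> 1 / 2")
      case True
      then show ?thesis unfolding \<mu> using strict_mono_on_malicious_share[OF one] by blast
    next
      case False
      then obtain l\<^sub>1 where l\<^sub>1: "l\<^sub>1 \<in> {M / (H + M)<..<1}" "running l\<^sub>1 = 1 / 2"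
        using running_half by auto
      then have "l\<^sub>1 \<in> {M / (H + M)..1}" by simp
      then show ?thesis
        unfolding \<mu> using l\<^sub>1 strict_mono_on_malicious_share[of l\<^sub>1]
          strict_antimono_on_malicious_share[of l\<^sub>1] by fastforce
    qed
  qed
qed

end
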